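(* Let $m\ge1$. For the canonical connection $\nabla^m$ on $\pi_{m,m-1}:J^m(E)\to J^{m-1}(E)$, the torsion form $\Omega_m=i_{D_\theta}d\omega_{m-1}$ satisfies $$\Omega_m=i_{D_\theta}d\omega_{m-1}=\omega_m,$$ where $\omega_m=ds_m-s_{m+1}\,d\theta$ is the highest-order contact form on $J^{m+1}(E)$.
   Context: Let $\mathcal H=L^2(\mu)$ and $E=\mathbb R\times\mathcal H\to\mathbb R$ the trivial bundle, $(\theta,s)\mapsto\theta$. The $m$-jet bundle is $J^m(E)=\mathbb R\times\mathcal H^{m+1}$ with coordinates $(\theta,s,s_1,\dots,s_m)$, $s,s_k\in\mathcal H$ ($s_0=s$). The contact forms are $\omega_k=ds_k-s_{k+1}\,d\theta$ ($\mathcal H$-valued), with $k=0,\dots,m-1$ on $J^m(E)$ and $k=0,\dots,m$ on $J^{m+1}(E)$; forms on $J^m(E)$ are pulled back to $J^{m+1}(E)$ by the projection forgetting $s_{m+1}$. The total derivative is the formal operator $$D_\theta=\frac{\partial}{\partial\theta}+\sum_{k\ge0}s_{k+1}\frac{\partial}{\partial s_k},$$ where $s_{k+1}\frac{\partial}{\partial s_k}$ is the tangent vector with component $s_{k+1}$ in the $s_k$-slot; on $J^{m+1}(E)$ it is taken with the sum over $0\le k\le m$. $i_Y$ denotes interior product, with $i_Y(\alpha\wedge\beta)=(i_Y\alpha)\beta-\alpha(i_Y\beta)$ for $1$-forms. The canonical connection $\nabla^m$ is the Ehresmann connection with horizontal bundle $H^m=\operatorname{span}\{D^{(m)}_\theta,\frac{\partial}{\partial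 s},\dots,\frac{\partial}{\partial s_{m-1}}\}$, where $D^{(m)}_\theta=\frac{\partial}{\partial\theta}+\sum_{k=0}^{m-1}s_{k+1}\frac{\partial}{\partial s_k}$; its torsion form is by definition $\Omega_m=i_{D_\theta}d\omega_{m-1}$. *)

theory Defs
  imports "HOL-Analysis.Analysis"
begin

section \<open>The Hilbert space $L^2(\mu)$\<close>

text \<open>
  The measure $\mu$ is the parameter of a type class without axioms, so a statement about
  \<open>'a L2\<close> for a type variable \<open>'a\<close> is a statement about an arbitrary measure.  The space is
  the usual one: measurable square-integrable real functions modulo equality almost everywhere.
\<close>

class base_measure =
  fixes mu :: "'a measure"

definition square_integrable :: "'a measure \<Rightarrow> ('a \<Rightarrow> real) \<Rightarrow> bool" where
  "square_integrable M f \<longleftrightarrow> f \<in> borel_measurable M \<and> integrable M (\<lambda>x. (f x)\<^sup>2)"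

lemma square_integrable_mult:
  assumes "square_integrable M f" "square_integrable M g"
  shows "integrable M (\<lambda>x. f x * g x)"
proof (rule Bochner_Integration.integrable_bound)
  show "integrable M (\<lambda>x. (f x)\<^sup>2 + (g x)\<^sup>2)"
    using assms by (auto simp: square_integrable_def)
  show "(\<lambda>x. f x * g x) \<in> borel_measurable M"
    using assms by (auto simp: square_integrable_def)
  have "\<bar>a * b\<bar> \<le> a\<^sup>2 + b\<^sup>2" for a b :: real
  proof -
    have "2 * \<bar>a * b\<bar> \<le> a\<^sup>2 + b\<^sup>2"
      using sum_squares_bound[of "\<bar>a\<bar>" "\<bar>b\<bar>"] by (simp add: abs_mult mult.assoc)
    then show ?thesis
      using abs_ge_zero[of "a * b"] by linarith
  qed
  then show "AE x in M. norm (f x * g x) \<le> norm ((f x)\<^sup>2 + (g x)\<^sup>2)"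
    by auto
qed

lemma square_integrable_add:
  assumes "square_integrable M f" "square_integrable M g"
  shows "square_integrable M (\<lambda>x. f x + g x)"
proof -
  have "integrable M (\<lambda>x. (f x)\<^sup>2 + (g x)\<^sup>2 + 2 * (f x * g x))"
    using assms square_integrable_mult[OF assms] by (auto simp: square_integrable_def)
  then show ?thesis
    using assms by (auto simp: square_integrable_def power2_sum mult.assoc)
qed

lemma square_integrable_scale:
  "square_integrable M f \<Longrightarrow> square_integrable M (\<lambda>x. c * f x)"
  by (auto simp: square_integrable_def power_mult_distrib)

lemma square_integrable_uminus:
  "square_integrable M f \<Longrightarrow> square_integrable M (\<lambda>x. - f x)"
  by (auto simp: square_integrable_def)

lemma square_integrable_diff:
  "square_integrable M f \<Longrightarrow> square_integrable M g \<Longrightarrow> square_integrable M (\<lambda>x. f x - g x)"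
  using square_integrable_add[of M f "\<lambda>x. - g x"] by (auto dest: square_integrable_uminus)

lemma square_integrable_zero: "square_integrable M (\<lambda>x. 0)"
  by (auto simp: square_integrable_def)

definition L2_rel :: "('a::base_measure \<Rightarrow> real) \<Rightarrow> ('a \<Rightarrow> real) \<Rightarrow> bool" where
  "L2_rel f g \<longleftrightarrow> square_integrable mu f \<and> square_integrable mu g \<and> (AE x in mu. f x = g x)"

quotient_type (overloaded) 'a L2 = "'a::base_measure \<Rightarrow> real" / partial: L2_rel
proof (rule part_equivpI)
  show "\<exists>x. L2_rel x x"
    using square_integrable_zero unfolding L2_rel_def by blast
  show "symp L2_rel"
    by (auto simp: symp_def L2_rel_def)
  show "transp L2_rel"
    by (auto simp: transp_def L2_rel_def)
qed

instantiation L2 :: (base_measure) real_inner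
begin

lift_definition zero_L2 :: "'a L2" is "\<lambda>x. 0"
  by (simp add: L2_rel_def square_integrable_zero)

lift_definition plus_L2 :: "'a L2 \<Rightarrow> 'a L2 \<Rightarrow> 'a L2" is "\<lambda>f g x. f x + g x"
  by (auto simp: L2_rel_def square_integrable_add)

lift_definition minus_L2 :: "'a L2 \<Rightarrow> 'a L2 \<Rightarrow> 'a L2" is "\<lambda>f g x. f x - g x"
  by (auto simp: L2_rel_def square_integrable_diff)

lift_definition uminus_L2 :: "'a L2 \<Rightarrow> 'a L2" is "\<lambda>f x. - f x"
  by (auto simp: L2_rel_def square_integrable_uminus)

lift_definition scaleR_L2 :: "real \<Rightarrow> 'a L2 \<Rightarrow> 'a L2" is "\<lambda>c f x. c * f x"
  by (auto simp: L2_rel_def square_integrable_scale)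

lift_definition inner_L2 :: "'a L2 \<Rightarrow> 'a L2 \<Rightarrow> real" is "\<lambda>f g. (\<integral>x. f x * g x \<partial>mu)"
  by (rule integral_cong_AE) (auto simp: L2_rel_def square_integrable_def)

definition norm_L2 :: "'a L2 \<Rightarrow> real" where
  "norm_L2 f = sqrt (inner f f)"

definition sgn_L2 :: "'a L2 \<Rightarrow> 'a L2" where
  "sgn_L2 f = scaleR (inverse (norm f)) f"

definition dist_L2 :: "'a L2 \<Rightarrow> 'a L2 \<Rightarrow> real" where
  "dist_L2 f g = norm (f - g)"

definition uniformity_L2 :: "('a L2 \<times> 'a L2) filter" where
  "uniformity_L2 = (INF e\<in>{0<..}. principal {(x, y). dist x y < e})"

definition open_L2 :: "'a L2 set \<Rightarrow> bool" where
  "open_L2 U = (\<forall>x\<in>U. eventually (\<lambda>(x', y). x' = x \<longrightarrow> y \<in> U) uniformity)"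

instance
proof
  fix f g h :: "'a L2" and a b :: real
  show "f + g + h = f + (g + h)"
    by transfer (auto simp: L2_rel_def add.assoc intro!: square_integrable_add)
  show "f + g = g + f"
    by transfer (auto simp: L2_rel_def add.commute intro!: square_integrable_add)
  show "0 + f = f"
    by transfer (auto simp: L2_rel_def)
  show "- f + f = 0"
    by transfer (auto simp: L2_rel_def square_integrable_zero)
  show "f - g = f + - g"
    by transfer (auto simp: L2_rel_def intro: square_integrable_diff)
  show "a *\<^sub>R (f + g) = a *\<^sub>R f + a *\<^sub>R g"
    by transfer (auto simp: L2_rel_def algebra_simps
      intro!: square_integrable_add square_integrable_scale)
  show "(a + b) *\<^sub>R f = a *\<^sub>R f + b *\<^sub>R f"
    by transfer (auto simp: L2_rel_def algebra_simps
      intro!: square_integrable_add square_integrable_scale)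
  show "a *\<^sub>R b *\<^sub>R f = (a * b) *\<^sub>R f"
    by transfer (auto simp: L2_rel_def mult.assoc dest: square_integrable_scale)
  show "1 *\<^sub>R f = f"
    by transfer (auto simp: L2_rel_def)
  show "inner f g = inner g f"
    by transfer (simp add: mult.commute)
  show "inner (f + g) h = inner f h + inner g h"
    by transfer (simp add: L2_rel_def distrib_right square_integrable_mult)
  show "inner (a *\<^sub>R f) g = a * inner f g"
    by transfer (simp add: mult.assoc)
  show "0 \<le> inner f f"
    by transfer (simp add: integral_nonneg_AE)
  show "inner f f = 0 \<longleftrightarrow> f = 0"
  proof transfer
    fix f :: "'a \<Rightarrow> real"
    assume "L2_rel f f"
    then have f: "square_integrable mu f"
      by (simp add: L2_rel_def)
    have "(\<integral>x. f x * f x \<partial>mu) = 0 \<longleftrightarrow> (AE x in mu. f x * f x = 0)"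
      by (rule integral_nonneg_eq_0_iff_AE) (auto intro: square_integrable_mult f)
    then show "(\<integral>x. f x * f x \<partial>mu) = 0 \<longleftrightarrow> L2_rel f (\<lambda>x. 0)"
      using f square_integrable_zero by (auto simp: L2_rel_def)
  qed
qed (simp_all add: norm_L2_def sgn_L2_def dist_L2_def uniformity_L2_def open_L2_def)

end


section \<open>Jet bundles\<close>

text \<open>
  Since the order of the jets varies, all jet bundles live in one ambient normed space
  \<open>real \<times> (nat \<Rightarrow>\<^sub>C 'h)\<close> of pairs $(\theta, (s_0, s_1, \dots))$ with a bounded sequence (every
  function on the discrete space \<^typ>\<open>nat\<close> is continuous).  \<open>jet_bundle n\<close> is the closed linear
  subspace where $s_k = 0$ for $k > n$; with the norm of the ambient space it is
  $\mathbb{R} \times \mathcal{H}^{n+1}$ up to equivalence of norms.  Being a vector space, it is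
  also the tangent space of the jet bundle at each of its points.
\<close>

type_synonym 'h jet = "real \<times> (nat \<Rightarrow>\<^sub>C 'h)"

definition theta :: "'h::real_normed_vector jet \<Rightarrow> real" where
  "theta p = fst p"

definition s_coord :: "nat \<Rightarrow> 'h::real_normed_vector jet \<Rightarrow> 'h" where
  "s_coord k p = apply_bcontfun (snd p) k"

definition jet_bundle :: "nat \<Rightarrow> 'h::real_normed_vector jet set" where
  "jet_bundle n = {p. \<forall>k>n. s_coord k p = 0}"

abbreviation tangent_space :: "nat \<Rightarrow> 'h::real_normed_vector jet \<Rightarrow> 'h jet set" where
  "tangent_space n p \<equiv> jet_bundle n"

definition slot :: "nat \<Rightarrow> 'h::real_normed_vector \<Rightarrow> (nat \<Rightarrow>\<^sub>C 'h)" where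
  "slot k h = Bcontfun (\<lambda>j. if j = k then h else 0)"

lemma apply_slot: "apply_bcontfun (slot k h) j = (if j = k then h else 0)"
proof -
  have "range (\<lambda>j. if j = k then h else 0) \<subseteq> {h, 0}"
    by auto
  then have "bounded (range (\<lambda>j. if j = k then h else 0))"
    by (rule bounded_subset[rotated]) simp
  then have "(\<lambda>j. if j = k then h else 0) \<in> bcontfun"
    by (simp add: bcontfun_def)
  then show ?thesis
    by (simp add: slot_def Bcontfun_inverse)
qed

definition partial_theta :: "'h::real_normed_vector jet" where
  "partial_theta = (1, 0)"

text \<open>\<open>partial_s k h\<close> is $h\,\partial/\partial s_k$.\<close>

definition partial_s :: "nat \<Rightarrow> 'h \<Rightarrow> 'h::real_normed_vector jet" where
  "partial_s k h = (0, slot k h)"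

text \<open>On \<open>jet_bundle n\<close> the coefficient $s_n$ is the last one available, hence $k < n$.\<close>

definition total_derivative :: "nat \<Rightarrow> 'h::real_normed_vector jet \<Rightarrow> 'h jet" where
  "total_derivative n p = partial_theta + (\<Sum>k<n. partial_s k (s_coord (Suc k) p))"

text \<open>The projection onto \<open>jet_bundle n\<close> that forgets all $s_k$ with $k > n$.\<close>

definition jet_proj :: "nat \<Rightarrow> 'h::real_normed_vector jet \<Rightarrow> 'h jet" where
  "jet_proj n p = (theta p, \<Sum>k\<le>n. slot k (s_coord k p))"

section \<open>Differential forms\<close>

text \<open>
  A form assigns a value to a point and tangent vectors.  On \<open>jet_bundle n\<close> only its values at
  points and tangent vectors of \<open>jet_bundle n\<close> matter.
\<close>

type_synonym ('h, 'v) form1 = "'h jet \<Rightarrow> 'h jet \<Rightarrow> 'v"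
type_synonym ('h, 'v) form2 = "'h jet \<Rightarrow> 'h jet \<Rightarrow> 'h jet \<Rightarrow> 'v"

text \<open>The coordinate functions are linear, so their differentials read off components.\<close>

definition d_theta :: "('h::real_normed_vector, real) form1" where
  "d_theta p v = theta v"

definition d_s :: "nat \<Rightarrow> ('h::real_normed_vector, 'h) form1" where
  "d_s k p v = s_coord k v"

definition contact_form :: "nat \<Rightarrow> ('h::real_normed_vector, 'h) form1" where
  "contact_form k p v = d_s k p v - d_theta p v *\<^sub>R s_coord (Suc k) p"

text \<open>
  On an open subset of a vector space,
  $d\alpha(u,v) = u(\alpha(v)) - v(\alpha(u)) - \alpha([u,v])$ for constant vector fields $u$, $v$,
  whose bracket vanishes.  There is no factor $1/2$, in accordance with
  $(\alpha\wedge\beta)(u,v) = \alpha(u)\beta(v) - \alpha(v)\beta(u)$ and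
  $i_Y(\alpha\wedge\beta) = (i_Y\alpha)\beta - \alpha(i_Y\beta)$.
  The choice made by \<^const>\<open>frechet_derivative\<close> does not matter: derivatives within a subspace
  are uniquely determined on the vectors of the subspace.
\<close>

definition ext_deriv ::
  "nat \<Rightarrow> ('h::real_normed_vector, 'v::real_normed_vector) form1 \<Rightarrow> ('h, 'v) form2" where
  "ext_deriv n \<alpha> p u v =
     frechet_derivative (\<lambda>q. \<alpha> q v) (at p within jet_bundle n) u
   - frechet_derivative (\<lambda>q. \<alpha> q u) (at p within jet_bundle n) v"

text \<open>\<open>pullback2 n F \<beta>\<close> is $F^*\beta$ on \<open>jet_bundle n\<close>.\<close>

definition pullback2 ::
  "nat \<Rightarrow> ('h::real_normed_vector jet \<Rightarrow> 'h jet) \<Rightarrow> ('h, 'v) form2 \<Rightarrow> ('h, 'v) form2" where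
  "pullback2 n F \<beta> p u v =
     \<beta> (F p) (frechet_derivative F (at p within jet_bundle n) u)
             (frechet_derivative F (at p within jet_bundle n) v)"

definition interior_product ::
  "('h jet \<Rightarrow> 'h jet) \<Rightarrow> ('h, 'v) form2 \<Rightarrow> ('h, 'v) form1" where
  "interior_product Y \<beta> p v = \<beta> p (Y p) v"

section \<open>The canonical connection and its torsion form\<close>

text \<open>
  The span contains all $h\,\partial/\partial s_k$ with $h \in \mathcal{H}$ and $k < m$.
\<close>

definition canonical_horizontal :: "nat \<Rightarrow> 'h::real_normed_vector jet \<Rightarrow> 'h jet set" where
  "canonical_horizontal m p =
     span (insert (total_derivative m p) {partial_s k h | k h. k < m})"

text \<open>The kernel of the derivative of $\pi_{m,m-1}$.\<close>

definition vertical :: "nat \<Rightarrow> 'h::real_normed_vector jet set" where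
  "vertical m = {v \<in> jet_bundle m. jet_proj (m - 1) v = 0}"

lemma s_coord_simps [simp]:
  fixes p q :: "'a::real_normed_vector jet" and h :: 'a and f :: "'i \<Rightarrow> 'a jet"
  shows "s_coord k (p + q) = s_coord k p + s_coord k q"
  "s_coord k (c *\<^sub>R p) = c *\<^sub>R s_coord k p"
  "s_coord k (0 :: 'a jet) = 0"
  "s_coord k (partial_theta :: 'a jet) = 0"
  "s_coord k (partial_s j h) = (if k = j then h else 0)"
  "s_coord k (sum f A) = (\<Sum>i\<in>A. s_coord k (f i))"
proof -
  show add: "s_coord k (p + q) = s_coord k p + s_coord k q" for p q :: "'a jet"
    by (simp add: s_coord_def)
  show "s_coord k (c *\<^sub>R p) = c *\<^sub>R s_coord k p"
    by (simp add: s_coord_def)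
  show zero: "s_coord k (0 :: 'a jet) = 0"
    by (simp add: s_coord_def)
  show "s_coord k (partial_theta :: 'a jet) = 0"
    by (simp add: s_coord_def partial_theta_def)
  show "s_coord k (partial_s j h) = (if k = j then h else 0)"
    by (simp add: s_coord_def partial_s_def apply_slot)
  show "s_coord k (sum f A) = (\<Sum>i\<in>A. s_coord k (f i))"
    by (induction A rule: infinite_finite_induct) (simp_all add: add zero)
qed

lemma theta_simps [simp]:
  "theta (p + q) = theta p + theta q"
  "theta (c *\<^sub>R p) = c * theta p"
  "theta 0 = 0"
  "theta partial_theta = 1"
  "theta (partial_s j h) = 0"
  "theta (sum f A) = (\<Sum>i\<in>A. theta (f i))"
  by (simp_all add: theta_def partial_theta_def partial_s_def fst_sum)

lemma jet_eqI: "theta p = theta q \<Longrightarrow> (\<And>k. s_coord k p = s_coord k q) \<Longrightarrow> p = q"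
  by (auto simp: theta_def s_coord_def prod_eq_iff intro: bcontfun_eqI)

lemma jet_proj_coord [simp]:
  "theta (jet_proj n p) = theta p"
  "s_coord k (jet_proj n p) = (if k \<le> n then s_coord k p else 0)"
proof -
  have eq: "jet_proj n p = theta p *\<^sub>R partial_theta + (\<Sum>j\<le>n. partial_s j (s_coord j p))"
    by (simp add: jet_proj_def partial_theta_def partial_s_def prod_eq_iff fst_sum snd_sum)
  show "theta (jet_proj n p) = theta p"
    by (simp add: jet_proj_def theta_def)
  show "s_coord k (jet_proj n p) = (if k \<le> n then s_coord k p else 0)"
    by (simp add: eq)
qed

lemma subspace_jet_bundle: "subspace (jet_bundle n)"
  by (auto simp: subspace_def jet_bundle_def)

text \<open>The horizontal and vertical spaces are complementary, i.e. \<open>canonical_horizontal\<close> is an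
  Ehresmann connection.\<close>

lemma canonical_horizontal_eq:
  assumes "m \<ge> 1" "p \<in> jet_bundle m"
  shows "canonical_horizontal m p = {v \<in> jet_bundle m. s_coord m v = 0}" (is "?H = ?K")
proof
  have "subspace ?K"
    by (rule subspaceI) (simp_all add: jet_bundle_def)
  moreover have "insert (total_derivative m p) {partial_s k h | k h. k < m} \<subseteq> ?K"
    by (auto simp: total_derivative_def jet_bundle_def)
  ultimately show "?H \<subseteq> ?K"
    unfolding canonical_horizontal_def by (rule span_minimal[rotated])
  show "?K \<subseteq> ?H"
  proof
    fix v :: "'a jet"
    assume v: "v \<in> ?K"
    let ?D = "total_derivative m p"
    have "v = theta v *\<^sub>R ?D + (\<Sum>k<m. partial_s k (s_coord k v - theta v *\<^sub>R s_coord (Suc k) p))"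
    proof (rule jet_eqI)
      fix k
      show "s_coord k v = s_coord k (theta v *\<^sub>R ?D
          + (\<Sum>k<m. partial_s k (s_coord k v - theta v *\<^sub>R s_coord (Suc k) p)))"
        using v by (cases k m rule: linorder_cases)
          (auto simp: total_derivative_def jet_bundle_def)
    qed (simp add: total_derivative_def)
    also have "\<dots> \<in> ?H"
      unfolding canonical_horizontal_def
      by (intro span_add span_scale span_sum span_base) auto
    finally show "v \<in> ?H" .
  qed
qed

lemma canonical_horizontal_complement:
  assumes "m \<ge> 1" "p \<in> jet_bundle m"
  shows "canonical_horizontal m p \<inter> vertical m = {0}"
    and "{x + y | x y. x \<in> canonical_horizontal m p \<and> y \<in> vertical m} = jet_bundle m"
proof -
  note H = canonical_horizontal_eq[OF assms]
  have V: "v \<in> vertical m \<longleftrightarrow> v \<in> jet_bundle m \<and> theta v = 0 \<and> (\<forall>k<m. s_coord k v = 0)"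
    for v :: "'a jet"
  proof -
    have "jet_proj (m - 1) v = 0 \<longleftrightarrow> theta v = 0 \<and> (\<forall>k<m. s_coord k v = 0)"
    proof
      assume z: "jet_proj (m - 1) v = 0"
      have "theta v = 0"
        using arg_cong[OF z, of theta] by simp
      moreover have "s_coord k v = 0" if "k < m" for k
        using arg_cong[OF z, of "s_coord k"] that by (simp split: if_splits)
      ultimately show "theta v = 0 \<and> (\<forall>k<m. s_coord k v = 0)"
        by simp
    next
      assume "theta v = 0 \<and> (\<forall>k<m. s_coord k v = 0)"
      then show "jet_proj (m - 1) v = 0"
        using assms(1) by (intro jet_eqI) auto
    qed
    then show ?thesis
      by (simp add: vertical_def)
  qed
  show "canonical_horizontal m p \<inter> vertical m = {0}"
  proof (intro equalityI subsetI)
    fix v assume v: "v \<in> canonical_horizontal m p \<inter> vertical m"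
    have "s_coord k v = 0" for k
      using v by (cases k m rule: linorder_cases) (auto simp: H V jet_bundle_def)
    then have "v = 0"
      using v by (intro jet_eqI) (auto simp: V)
    then show "v \<in> {0}"
      by simp
  qed (auto simp: H V jet_bundle_def)
  show "{x + y | x y. x \<in> canonical_horizontal m p \<and> y \<in> vertical m} = jet_bundle m"
  proof (intro equalityI subsetI)
    fix v :: "'a jet" assume v: "v \<in> jet_bundle m"
    have "jet_proj (m - 1) v \<in> canonical_horizontal m p"
      using assms(1) by (auto simp: H jet_bundle_def)
    moreover have "partial_s m (s_coord m v) \<in> vertical m"
      by (auto simp: V jet_bundle_def)
    moreover have "v = jet_proj (m - 1) v + partial_s m (s_coord m v)"
    proof (rule jet_eqI)
      fix k
      show "s_coord k v = s_coord k (jet_proj (m - 1) v + partial_s m (s_coord m v))"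
        using v assms(1) by (cases k m rule: linorder_cases) (auto simp: jet_bundle_def)
    qed simp
    ultimately show "v \<in> {x + y | x y. x \<in> canonical_horizontal m p \<and> y \<in> vertical m}"
      by blast
  next
    fix v :: "'a jet"
    assume "v \<in> {x + y | x y. x \<in> canonical_horizontal m p \<and> y \<in> vertical m}"
    then obtain x y where "v = x + y" "x \<in> jet_bundle m" "y \<in> jet_bundle m"
      unfolding H V by blast
    then show "v \<in> jet_bundle m"
      by (simp add: subspace_add[OF subspace_jet_bundle])
  qed
qed

text \<open>
  The contact form $\omega_{m-1}$ lives on \<open>jet_bundle m\<close>; its exterior derivative is pulled back
  to \<open>jet_bundle (m + 1)\<close>, where it is contracted with the total derivative.
\<close>

definition torsion_form :: "nat \<Rightarrow> ('h::real_normed_vector, 'h) form1" where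
  "torsion_form m =
     interior_product (total_derivative (m + 1))
       (pullback2 (m + 1) (jet_proj m) (ext_deriv m (contact_form (m - 1))))"

end

theory Submission
  imports Defs
begin

text \<open>
  The coordinates are bounded linear, so all derivatives are explicit:
  $d\omega_{m-1}(u,v) = \theta(u)\,s_m(v) - \theta(v)\,s_m(u)$, i.e.\
  $d\omega_{m-1} = d\theta\wedge ds_m$.  Contracting with $D_\theta$, for which $\theta = 1$ and
  $s_m = s_{m+1}$, leaves $ds_m - s_{m+1}\,d\theta$.
\<close>

text \<open>
  Restricting to the line through \<open>p\<close> in the direction \<open>u\<close> reduces this to the uniqueness of
  derivatives on the real line.
\<close>

lemma frechet_derivative_within_subspace:
  fixes f :: "'a::real_normed_vector \<Rightarrow> 'b::real_normed_vector"
  assumes "subspace S" "p \<in> S" "u \<in> S" and f: "(f has_derivative f') (at p within S)"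
  shows "frechet_derivative f (at p within S) u = f' u"
proof -
  \<comment> \<open>Kept general in \<open>g\<close>, because it is applied both to
    \<open>f'\<close> and to the derivative that \<open>frechet_derivative\<close> selects.\<close>
  have line: "((\<lambda>t. f (p + t *\<^sub>R u)) has_derivative (\<lambda>t. g (t *\<^sub>R u))) (at 0)"
    if g: "(f has_derivative g) (at p within S)" for g
  proof -
    have "range (\<lambda>t. p + t *\<^sub>R u) \<subseteq> S"
      using assms by (auto intro!: subspace_add subspace_scale)
    \<comment> \<open>Writing the base point as the value of the line at \<open>t = 0\<close> gives
      it the shape that the chain rule expects.\<close>
    then have "(f has_derivative g) (at (p + 0 *\<^sub>R u) within range (\<lambda>t. p + t *\<^sub>R u))"
      using has_derivative_subset[OF g] by simp
    moreover have "((\<lambda>t. p + t *\<^sub>R u) has_derivative (\<lambda>t. t *\<^sub>R u)) (at 0)"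
      by (auto intro!: derivative_eq_intros)
    ultimately show ?thesis
      by (rule has_derivative_in_compose[rotated])
  qed
  have "(f has_derivative frechet_derivative f (at p within S)) (at p within S)"
    using f by (auto simp: frechet_derivative_works[symmetric] differentiable_def)
  \<comment> \<open>Both maps are derivatives at \<open>0\<close> of one function on the whole real
    line, hence equal; \<open>t = 1\<close> gives their values at \<open>u\<close>.\<close>
  from has_derivative_unique[OF line[OF this] line[OF f]] show ?thesis
    by (metis scaleR_one)
qed

lemma bounded_linear_theta: "bounded_linear (theta :: 'h::real_normed_vector jet \<Rightarrow> real)"
  unfolding theta_def by (rule bounded_linear_fst)

lemma bounded_linear_s_coord:
  "bounded_linear (s_coord k :: 'h::real_normed_vector jet \<Rightarrow> 'h)"
proof (rule bounded_linear_intro[where K = 1])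
  fix p :: "'h jet"
  show "norm (s_coord k p) \<le> norm p * 1"
    using norm_bounded[of "snd p" k] norm_snd_le[of "snd p" "fst p"] by (simp add: s_coord_def)
qed simp_all

lemma bounded_linear_partial_s:
  "bounded_linear (partial_s k :: 'h::real_normed_vector \<Rightarrow> 'h jet)"
proof (rule bounded_linear_intro[where K = 1])
  fix h :: 'h
  show "norm (partial_s k h) \<le> norm h * 1"
    by (auto simp: partial_s_def norm_Pair apply_slot intro!: norm_bound)
qed (auto intro: jet_eqI)

lemma bounded_linear_jet_proj:
  "bounded_linear (jet_proj n :: 'h::real_normed_vector jet \<Rightarrow> 'h jet)"
proof -
  have "jet_proj n = (\<lambda>p :: 'h jet. theta p *\<^sub>R partial_theta + (\<Sum>k\<le>n. partial_s k (s_coord k p)))"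
    by (auto intro!: jet_eqI)
  then show ?thesis
    by (auto intro!: bounded_linear_add bounded_linear_sum bounded_linear_scaleR_const
      bounded_linear_theta bounded_linear_compose[OF bounded_linear_partial_s bounded_linear_s_coord])
qed

lemma jet_proj_in_jet_bundle: "jet_proj n p \<in> jet_bundle n"
  by (simp add: jet_bundle_def)

lemma total_derivative_in_jet_bundle: "total_derivative n p \<in> jet_bundle n"
  by (auto simp: total_derivative_def jet_bundle_def)

lemma theta_total_derivative: "theta (total_derivative n p) = 1"
  by (simp add: total_derivative_def)

lemma s_coord_total_derivative:
  "k < n \<Longrightarrow> s_coord k (total_derivative n p) = s_coord (Suc k) p"
  by (simp add: total_derivative_def)

text \<open>With the vector argument fixed, only the coefficient of \<open>d_theta\<close> varies
  with the point, and it does so linearly. This is the formula for the wedge of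
  \<open>d_theta\<close> with \<open>d_s (Suc k)\<close>.\<close>

lemma ext_deriv_contact_form:
  assumes "p \<in> jet_bundle n" "u \<in> jet_bundle n" "v \<in> jet_bundle n"
  shows "ext_deriv n (contact_form k) p u v
    = theta u *\<^sub>R s_coord (Suc k) v - theta v *\<^sub>R s_coord (Suc k) u"
proof -
  have "((\<lambda>q. contact_form k q y) has_derivative (\<lambda>x. - (theta y *\<^sub>R s_coord (Suc k) x)))
      (at p within jet_bundle n)" for y :: "'a jet"
    unfolding contact_form_def d_s_def d_theta_def
    by (auto intro!: derivative_eq_intros bounded_linear_imp_has_derivative bounded_linear_s_coord)
  from frechet_derivative_within_subspace[OF subspace_jet_bundle assms(1) _ this] show ?thesis
    using assms by (simp add: ext_deriv_def)
qed

text \<open>The projection is bounded linear, so it is its own derivative at every point.\<close>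

lemma pullback2_jet_proj:
  assumes "p \<in> jet_bundle n" "u \<in> jet_bundle n" "v \<in> jet_bundle n"
  shows "pullback2 n (jet_proj l) \<beta> p u v = \<beta> (jet_proj l p) (jet_proj l u) (jet_proj l v)"
  using assms by (simp add: pullback2_def frechet_derivative_within_subspace[OF subspace_jet_bundle
    _ _ bounded_linear_imp_has_derivative[OF bounded_linear_jet_proj]])

lemma torsion_form_eq_contact_form:
  assumes "m \<ge> 1" "p \<in> jet_bundle (m + 1)" "v \<in> jet_bundle (m + 1)"
  shows "torsion_form m p v = contact_form m p v"
proof -
  have "torsion_form m p v = ext_deriv m (contact_form (m - 1)) (jet_proj m p)
      (jet_proj m (total_derivative (m + 1) p)) (jet_proj m v)"
    unfolding torsion_form_def interior_product_def
    by (rule pullback2_jet_proj[OF assms(2) total_derivative_in_jet_bundle assms(3)])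
  then show ?thesis
    \<comment> \<open>\<open>m \<ge> 1\<close> gives \<open>Suc (m - 1) = m\<close>. The total
      derivative is taken at order \<open>m + 1\<close>, so its component in slot \<open>m\<close>,
      which \<open>jet_proj m\<close> keeps, is \<open>s_coord (Suc m) p\<close>.\<close>
    using assms(1)
    by (simp add: ext_deriv_contact_form jet_proj_in_jet_bundle theta_total_derivative
      s_coord_total_derivative contact_form_def d_s_def d_theta_def)
qed

theorem proposition2p2:
  fixes m :: nat
  assumes "m \<ge> 1"
  shows "\<forall>p \<in> (jet_bundle (m + 1) :: 'a::base_measure L2 jet set). \<forall>v \<in> tangent_space (m + 1) p.
           torsion_form m p v =
             interior_product (total_derivative (m + 1))
               (pullback2 (m + 1) (jet_proj m) (ext_deriv m (contact_form (m - 1)))) p v \<and>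
           torsion_form m p v = contact_form m p v"
proof (intro ballI conjI)
  fix p v :: "'a L2 jet"
  assume "p \<in> jet_bundle (m + 1)" "v \<in> tangent_space (m + 1) p"
  with assms show "torsion_form m p v = contact_form m p v"
    by (rule torsion_form_eq_contact_form)
\<comment> \<open>The remaining equation is the definition of the torsion form.\<close>
qed (simp only: torsion_form_def)

end
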